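(* Let $(S,s)$ be a finite bijective set-theoretic solution to the Pentagon Equation. Then there exist a matched pair of groups $(A,G,\sigma,\delta)$, a set $X$ and maps $\varphi_a\in \mathrm{Sym}(X)$, for all $a\in A$, such that $S$, as a set, is (i.e. can be identified via a bijection with) the Cartesian product $X\times A\times G$ and, under this identification, $s$ is of the form $$s((\alpha,a,x),(\beta,b,y))=\big((\alpha,a,xy),\ (\varphi_{b(\delta_x(a))^{-1}}^{-1}\varphi_b(\beta),\ b(\delta_x(a))^{-1},\ \sigma_{\delta_x(a)}(y))\big)\qquad(\star)$$ for all $\alpha,\beta\in X$, $a,b\in A$ and $x,y\in G$. Moreover, for any matched pair of groups $(A,G,\sigma,\delta)$, any set $X$ and any maps $\varphi_a\in\mathrm{Sym}(X)$, defined for all $a\in A$, the map $s$ defined on $S=X\times A\times G$ by $(\star)$ is a bijective set-theoretic solution to the Pentagon Equation.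
   Context: A set-theoretic solution to the Pentagon Equation is a pair $(S,s)$ with $S$ a nonempty set and $s:S\times S\to S\times S$ a map such that $s_{23}s_{13}s_{12}=s_{12}s_{23}$ on $S\times S\times S$, where $s_{12}=s\times\mathrm{id}$, $s_{23}=\mathrm{id}\times s$, $s_{13}=(\tau\times\mathrm{id})(\mathrm{id}\times s)(\tau\times\mathrm{id})$ and $\tau(x,y)=(y,x)$. It is finite if $S$ is finite, and bijective if $s$ is bijective. A matched pair of groups $(A,G,\sigma,\delta)$ (the two groups may also be listed in the other order, $(G,A,\sigma,\delta)$) consists of groups $A$ and $G$, a left action $\sigma:A\to\mathrm{Sym}(G)$, $a\mapsto\sigma_a$ (so $\sigma_{ab}=\sigma_a\sigma_b$), and a right action $\delta:G\to\mathrm{Sym}(A)$, $x\mapsto\delta_x$ (so $\delta_{xy}=\delta_y\delta_x$), such that for all $a,b\in A$, $x,y\in G$: $\sigma_a(xy)=\sigma_a(x)\,\sigma_{\delta_x(a)}(y)$ and $\delta_x(ab)=\delta_{\sigma_b(x)}(a)\,\delta_x(b)$. *)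

theory Defs
  imports "HOL-Algebra.Group_Action"
begin

text \<open>Triples are nested to the right, so \<open>id \<times> f\<close> is a plain \<^const>\<open>map_prod\<close>
  whereas \<open>f \<times> id\<close> has to reassociate.\<close>

definition on12 :: "('s \<times> 's \<Rightarrow> 's \<times> 's) \<Rightarrow> 's \<times> 's \<times> 's \<Rightarrow> 's \<times> 's \<times> 's" where
  "on12 f = (\<lambda>(p, q, r). case f (p, q) of (u, v) \<Rightarrow> (u, v, r))"

definition on23 :: "('s \<times> 's \<Rightarrow> 's \<times> 's) \<Rightarrow> 's \<times> 's \<times> 's \<Rightarrow> 's \<times> 's \<times> 's" where
  "on23 f = map_prod id f"

definition on13 :: "('s \<times> 's \<Rightarrow> 's \<times> 's) \<Rightarrow> 's \<times> 's \<times> 's \<Rightarrow> 's \<times> 's \<times> 's" where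
  "on13 f = on12 prod.swap \<circ> on23 f \<circ> on12 prod.swap"

definition pentagon_solution :: "'s set \<Rightarrow> ('s \<times> 's \<Rightarrow> 's \<times> 's) \<Rightarrow> bool" where
  "pentagon_solution S s \<longleftrightarrow>
     S \<noteq> {} \<and> s \<in> S \<times> S \<rightarrow> S \<times> S \<and>
     (\<forall>t \<in> S \<times> S \<times> S. (on23 s \<circ> on13 s \<circ> on12 s) t = (on12 s \<circ> on23 s) t)"

definition bijective_pentagon_solution :: "'s set \<Rightarrow> ('s \<times> 's \<Rightarrow> 's \<times> 's) \<Rightarrow> bool" where
  "bijective_pentagon_solution S s \<longleftrightarrow>
     pentagon_solution S s \<and> bij_betw s (S \<times> S) (S \<times> S)"

text \<open>\<open>Bij S\<close> is the carrier of the symmetric group \<^const>\<open>BijGroup\<close>, whose product is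
  \<open>(f g)(x) = f (g x)\<close>; hence \<^const>\<open>group_action\<close> is a left action. The right action is
  spelled out, as the library has only left ones.\<close>

locale matched_pair =
  A: group A + G: group G + left: group_action A "carrier G" \<sigma>
  for A :: "('a, 'm) monoid_scheme" and G :: "('g, 'n) monoid_scheme"
    and \<sigma> :: "'a \<Rightarrow> 'g \<Rightarrow> 'g" and \<delta> :: "'g \<Rightarrow> 'a \<Rightarrow> 'a" +
  assumes right_bij: "\<delta> \<in> carrier G \<rightarrow> Bij (carrier A)"
    and right_mult: "\<lbrakk>x \<in> carrier G; y \<in> carrier G; a \<in> carrier A\<rbrakk>
          \<Longrightarrow> \<delta> (x \<otimes>\<^bsub>G\<^esub> y) a = \<delta> y (\<delta> x a)"
    and left_compat: "\<lbrakk>a \<in> carrier A; x \<in> carrier G; y \<in> carrier G\<rbrakk>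
          \<Longrightarrow> \<sigma> a (x \<otimes>\<^bsub>G\<^esub> y) = \<sigma> a x \<otimes>\<^bsub>G\<^esub> \<sigma> (\<delta> x a) y"
    and right_compat: "\<lbrakk>x \<in> carrier G; a \<in> carrier A; b \<in> carrier A\<rbrakk>
          \<Longrightarrow> \<delta> x (a \<otimes>\<^bsub>A\<^esub> b) = \<delta> (\<sigma> b x) a \<otimes>\<^bsub>A\<^esub> \<delta> x b"

definition matched_pair_map ::
    "('a, 'm) monoid_scheme \<Rightarrow> ('g, 'n) monoid_scheme \<Rightarrow> ('a \<Rightarrow> 'g \<Rightarrow> 'g) \<Rightarrow> ('g \<Rightarrow> 'a \<Rightarrow> 'a)
     \<Rightarrow> 'x set \<Rightarrow> ('a \<Rightarrow> 'x \<Rightarrow> 'x)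
     \<Rightarrow> ('x \<times> 'a \<times> 'g) \<times> ('x \<times> 'a \<times> 'g) \<Rightarrow> ('x \<times> 'a \<times> 'g) \<times> ('x \<times> 'a \<times> 'g)" where
  "matched_pair_map A G \<sigma> \<delta> X \<phi> =
     (\<lambda>((\<alpha>, a, x), (\<beta>, b, y)).
        ((\<alpha>, a, x \<otimes>\<^bsub>G\<^esub> y),
         (inv_into X (\<phi> (b \<otimes>\<^bsub>A\<^esub> inv\<^bsub>A\<^esub> (\<delta> x a))) (\<phi> b \<beta>),
          b \<otimes>\<^bsub>A\<^esub> inv\<^bsub>A\<^esub> (\<delta> x a),
          \<sigma> (\<delta> x a) y)))"

end

theory Submission
  imports Defs
begin

text \<open>Write \<open>s(x, y) = (x y, \<theta>\<^sub>x(y))\<close>. The pentagon equation says that the product is associative,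
  \<open>\<theta>\<^sub>x(y z) = \<theta>\<^sub>x(y) \<theta>\<^bsub>xy\<^esub>(z)\<close>, and \<open>\<theta>\<close> at \<open>\<theta>\<^sub>x(y)\<close>, composed with \<open>\<theta>\<^bsub>xy\<^esub>\<close>, equals \<open>\<theta>\<^sub>y\<close>.
  Let \<open>L\<close> be a minimal left ideal. Counting gives \<open>x u \<in> L\<close> iff \<open>u \<in> L\<close>; for \<open>w \<in> L\<close> and a right
  identity \<open>e\<close> of \<open>L\<close>, every \<open>v \<in> S\<close> is \<open>\<theta>\<^sub>x(u)\<close> for some \<open>x u = w\<close>, so
  \<open>v = \<theta>\<^sub>x(u e) = v \<theta>\<^sub>w(e)\<close>. The right identity \<open>\<theta>\<^sub>w(e)\<close> then lies in \<open>L\<close>, whence \<open>L = S\<close> and the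
  semigroup is a left group: left zeros (the idempotents) times a group \<open>G\<close>. Each \<open>\<theta>\<^sub>x\<close> permutes the
  idempotents, no other element maps to an idempotent, and so \<open>\<theta>\<^sub>x\<close> is injective. The group \<open>A\<close> consists of
  all \<open>\<theta>\<^sub>x\<close>; it acts freely on the idempotents, and \<open>e \<mapsto> (\<theta>\<^sub>e(e), \<theta>\<^sub>e)\<close> splits them as
  \<open>X \<times> A\<close> with \<open>X = {e. \<theta>\<^sub>e = id}\<close>. The action of \<open>A\<close> on \<open>G\<close> is induced by \<open>\<theta>\<close>, and
  \<open>\<delta>\<^sub>x(\<theta>\<^sub>e) = \<theta>\<^bsub>ex\<^esub>\<close>.\<close>

section \<open>Identities in a matched pair of groups\<close>

lemma (in matched_pair) right_one: "a \<in> carrier A \<Longrightarrow> \<delta> \<one>\<^bsub>G\<^esub> a = a"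
proof -
  assume a: "a \<in> carrier A"
  have b: "\<delta> \<one>\<^bsub>G\<^esub> \<in> Bij (carrier A)" using right_bij by auto
  have inj: "inj_on (\<delta> \<one>\<^bsub>G\<^esub>) (carrier A)" and cl: "\<delta> \<one>\<^bsub>G\<^esub> a \<in> carrier A"
    using b a by (auto simp: Bij_def bij_betw_def)
  have "\<delta> \<one>\<^bsub>G\<^esub> (\<delta> \<one>\<^bsub>G\<^esub> a) = \<delta> \<one>\<^bsub>G\<^esub> a"
    using right_mult[of "\<one>\<^bsub>G\<^esub>" "\<one>\<^bsub>G\<^esub>" a] a by simp
  \<comment> \<open>Injectivity cancels one application of the idempotent map.\<close>
  then show ?thesis using inj cl a by (auto dest: inj_onD)
qed

lemma (in matched_pair) right_closed:
  "\<lbrakk>x \<in> carrier G; a \<in> carrier A\<rbrakk> \<Longrightarrow> \<delta> x a \<in> carrier A"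
  using right_bij by (auto simp: Bij_def bij_betw_def Pi_def)

lemma (in matched_pair) left_closed:
  "\<lbrakk>a \<in> carrier A; x \<in> carrier G\<rbrakk> \<Longrightarrow> \<sigma> a x \<in> carrier G"
  using left.element_image by blast

lemma (in matched_pair) left_mult:
  "\<lbrakk>a \<in> carrier A; b \<in> carrier A; x \<in> carrier G\<rbrakk> \<Longrightarrow> \<sigma> (a \<otimes>\<^bsub>A\<^esub> b) x = \<sigma> a (\<sigma> b x)"
  using left.composition_rule by blast

lemma (in matched_pair) left_one: "x \<in> carrier G \<Longrightarrow> \<sigma> \<one>\<^bsub>A\<^esub> x = x"
  using left.id_eq_one by (metis restrict_apply')

text \<open>The image of the unit is idempotent by \<open>right_compat\<close>, hence the
  unit.\<close>

lemma (in matched_pair) right_of_one: "x \<in> carrier G \<Longrightarrow> \<delta> x \<one>\<^bsub>A\<^esub> = \<one>\<^bsub>A\<^esub>"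
  using right_compat[of x "\<one>\<^bsub>A\<^esub>" "\<one>\<^bsub>A\<^esub>"] right_closed[of x "\<one>\<^bsub>A\<^esub>"]
  by (simp add: left_one)

text \<open>Apply \<open>right_compat\<close> to the product of the inverse of \<open>c\<close> with
  \<open>c\<close>. This lets \<open>\<delta> x a\<close> be recovered from the output of the
  map.\<close>

lemma (in matched_pair) right_inv:
  assumes "c \<in> carrier A" "y \<in> carrier G"
  shows "inv\<^bsub>A\<^esub> (\<delta> y c) = \<delta> (\<sigma> c y) (inv\<^bsub>A\<^esub> c)"
proof -
  have "\<delta> (\<sigma> c y) (inv\<^bsub>A\<^esub> c) \<otimes>\<^bsub>A\<^esub> \<delta> y c = \<one>\<^bsub>A\<^esub>"
    using right_compat[of y "inv\<^bsub>A\<^esub> c" c] assms by (simp add: right_of_one)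
  then show ?thesis
    using assms A.inv_equality by (auto simp: left_closed right_closed)
qed

lemma Bij_closed: "f \<in> Bij X \<Longrightarrow> x \<in> X \<Longrightarrow> f x \<in> X"
  by (auto simp: Bij_def bij_betw_def)

lemma Bij_inv_closed: "f \<in> Bij X \<Longrightarrow> x \<in> X \<Longrightarrow> inv_into X f x \<in> X"
  by (auto simp: Bij_def bij_betw_def inv_into_into)

lemma Bij_f_inv: "f \<in> Bij X \<Longrightarrow> x \<in> X \<Longrightarrow> f (inv_into X f x) = x"
  by (auto simp: Bij_def bij_betw_def f_inv_into_f)

lemma Bij_inv_f: "f \<in> Bij X \<Longrightarrow> x \<in> X \<Longrightarrow> inv_into X f (f x) = x"
  by (auto simp: Bij_def bij_betw_def)

section \<open>The map of a matched pair as a bijective solution\<close>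

locale matched_pair_maps = matched_pair A G \<sigma> \<delta>
  for A :: "('a, 'm) monoid_scheme" and G :: "('g, 'n) monoid_scheme" and \<sigma> \<delta> +
  fixes X :: "'x set" and \<phi> :: "'a \<Rightarrow> 'x \<Rightarrow> 'x"
  assumes maps: "\<phi> \<in> carrier A \<rightarrow> Bij X"
begin

lemma maps_Bij: "a \<in> carrier A \<Longrightarrow> \<phi> a \<in> Bij X"
  using maps by auto

lemmas closures = left_closed right_closed Bij_closed[OF maps_Bij] Bij_inv_closed[OF maps_Bij]
  Bij_f_inv[OF maps_Bij] Bij_inv_f[OF maps_Bij]

lemma matched_pair_map_closed:
  "matched_pair_map A G \<sigma> \<delta> X \<phi> \<in> (X \<times> carrier A \<times> carrier G) \<times> (X \<times> carrier A \<times> carrier G)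
     \<rightarrow> (X \<times> carrier A \<times> carrier G) \<times> (X \<times> carrier A \<times> carrier G)"
  by (auto simp: matched_pair_map_def closures)

text \<open>Apart from \<open>left_compat\<close> for the second output, the identity rests on the
  factorization \<open>kc\<close> of \<open>\<delta> y b\<close>; the maps \<open>\<phi>\<close> in
  the third output telescope.\<close>

lemma matched_pair_map_pentagon:
  assumes "\<alpha> \<in> X" "a \<in> carrier A" "x \<in> carrier G" "\<beta> \<in> X" "b \<in> carrier A" "y \<in> carrier G"
    "\<gamma> \<in> X" "d \<in> carrier A" "z \<in> carrier G"
  defines "s \<equiv> matched_pair_map A G \<sigma> \<delta> X \<phi>"
  shows "(on23 s \<circ> on13 s \<circ> on12 s) ((\<alpha>, a, x), (\<beta>, b, y), (\<gamma>, d, z))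
    = (on12 s \<circ> on23 s) ((\<alpha>, a, x), (\<beta>, b, y), (\<gamma>, d, z))"
proof -
  \<comment> \<open>On the first two points \<open>s\<close> uses \<open>c\<close>; when their
    second output later acts on the third point, \<open>k\<close> takes the place of
    \<open>c\<close>.\<close>
  define c where "c = \<delta> x a"
  define k where "k = \<delta> (\<sigma> c y) (b \<otimes>\<^bsub>A\<^esub> inv\<^bsub>A\<^esub> c)"
  have c: "c \<in> carrier A" using assms by (simp add: c_def closures)
  have k: "k \<in> carrier A" using assms c by (simp add: k_def closures)
  have xy: "\<delta> (x \<otimes>\<^bsub>G\<^esub> y) a = \<delta> y c" using assms by (simp add: c_def right_mult)
  have kc: "\<delta> y b = k \<otimes>\<^bsub>A\<^esub> \<delta> y c"
    using right_compat[of y "b \<otimes>\<^bsub>A\<^esub> inv\<^bsub>A\<^esub> c" c] assms c by (simp add: k_def A.m_assoc)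
  have db: "d \<otimes>\<^bsub>A\<^esub> inv\<^bsub>A\<^esub> (\<delta> y b) = d \<otimes>\<^bsub>A\<^esub> inv\<^bsub>A\<^esub> (\<delta> y c) \<otimes>\<^bsub>A\<^esub> inv\<^bsub>A\<^esub> k"
    using assms c k by (simp add: kc A.inv_mult_group A.m_assoc closures)
  have sb: "\<sigma> (\<delta> y b) z = \<sigma> k (\<sigma> (\<delta> y c) z)"
    using assms c k by (simp add: kc left_mult closures)
  have sc: "\<sigma> c (y \<otimes>\<^bsub>G\<^esub> z) = \<sigma> c y \<otimes>\<^bsub>G\<^esub> \<sigma> (\<delta> y c) z"
    using assms c by (simp add: left_compat)
  show ?thesis
    using assms(1-9) c k
    by (simp add: s_def on12_def on13_def on23_def matched_pair_map_def closures xy sc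
        flip: c_def k_def) (simp add: sb db closures G.m_assoc)
qed

lemma matched_pair_map_bij:
  "bij_betw (matched_pair_map A G \<sigma> \<delta> X \<phi>)
     ((X \<times> carrier A \<times> carrier G) \<times> (X \<times> carrier A \<times> carrier G))
     ((X \<times> carrier A \<times> carrier G) \<times> (X \<times> carrier A \<times> carrier G))"
proof -
  \<comment> \<open>From \<open>u = x y\<close>, \<open>y' = \<sigma>\<^sub>c(y)\<close> and \<open>d = \<delta>\<^sub>u(a) = \<delta>\<^sub>y(c)\<close>, where \<open>c = \<delta>\<^sub>x(a)\<close>,
    one recovers \<open>c\<close> because \<open>\<delta>\<close> at \<open>y'\<close> maps \<open>c\<inverse>\<close> to \<open>d\<inverse>\<close>.\<close>
  define cc where "cc a u y' = inv\<^bsub>A\<^esub> (\<delta> (inv\<^bsub>G\<^esub> y') (inv\<^bsub>A\<^esub> (\<delta> u a)))" for a u y'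
  define t where "t = (\<lambda>((\<alpha>::'x, a, u), (\<beta>', b', y')).
     let c = cc a u y'; y = \<sigma> (inv\<^bsub>A\<^esub> c) y'; b = b' \<otimes>\<^bsub>A\<^esub> c in
     ((\<alpha>, a, u \<otimes>\<^bsub>G\<^esub> inv\<^bsub>G\<^esub> y), (inv_into X (\<phi> b) (\<phi> b' \<beta>'), b, y)))"
  let ?S = "X \<times> carrier A \<times> carrier G"
  let ?s = "matched_pair_map A G \<sigma> \<delta> X \<phi>"
  have cc: "cc a u y' \<in> carrier A" if "a \<in> carrier A" "u \<in> carrier G" "y' \<in> carrier G" for a u y'
    using that by (simp add: cc_def closures)
  show ?thesis
  proof (rule bij_betw_byWitness[where f' = t])
    have "t (?s ((\<alpha>, a, x), (\<beta>, b, y))) = ((\<alpha>, a, x), (\<beta>, b, y))"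
      if "\<alpha> \<in> X" "a \<in> carrier A" "x \<in> carrier G" "\<beta> \<in> X" "b \<in> carrier A" "y \<in> carrier G"
      for \<alpha> a x \<beta> b y
    proof -
      define c where "c = \<delta> x a"
      have c: "c \<in> carrier A" using that by (simp add: c_def closures)
      have "inv\<^bsub>A\<^esub> (\<delta> (x \<otimes>\<^bsub>G\<^esub> y) a) = \<delta> (\<sigma> c y) (inv\<^bsub>A\<^esub> c)"
        using that c right_inv[of c y] by (simp add: right_mult c_def)
      then have ccc: "cc a (x \<otimes>\<^bsub>G\<^esub> y) (\<sigma> c y) = c"
        using right_mult[of "\<sigma> c y" "inv\<^bsub>G\<^esub> (\<sigma> c y)" "inv\<^bsub>A\<^esub> c"] that c
        by (simp add: cc_def closures right_one)
      have sy: "\<sigma> (inv\<^bsub>A\<^esub> c) (\<sigma> c y) = y"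
        using left_mult[of "inv\<^bsub>A\<^esub> c" c y] that c by (simp add: left_one)
      show ?thesis using that c
        by (simp add: t_def matched_pair_map_def Let_def ccc sy A.m_assoc G.m_assoc closures
            flip: c_def)
    qed
    then show "\<forall>p \<in> ?S \<times> ?S. t (?s p) = p" by auto
    have "?s (t ((\<alpha>, a, u), (\<beta>, b, y'))) = ((\<alpha>, a, u), (\<beta>, b, y'))"
      if "\<alpha> \<in> X" "a \<in> carrier A" "u \<in> carrier G" "\<beta> \<in> X" "b \<in> carrier A" "y' \<in> carrier G"
      for \<alpha> a u \<beta> b y'
    proof -
      define c where "c = cc a u y'"
      define y where "y = \<sigma> (inv\<^bsub>A\<^esub> c) y'"
      have c: "c \<in> carrier A" using that cc by (simp add: c_def)
      have y: "y \<in> carrier G" using that c by (simp add: y_def closures)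
      have sy: "\<sigma> c y = y'"
        using left_mult[of c "inv\<^bsub>A\<^esub> c" y'] that c by (simp add: y_def left_one)
      have "inv\<^bsub>A\<^esub> c = \<delta> (inv\<^bsub>G\<^esub> y') (inv\<^bsub>A\<^esub> (\<delta> u a))"
        using that by (simp add: c_def cc_def closures)
      then have "\<delta> y' (inv\<^bsub>A\<^esub> c) = inv\<^bsub>A\<^esub> (\<delta> u a)"
        using right_mult[of "inv\<^bsub>G\<^esub> y'" y' "inv\<^bsub>A\<^esub> (\<delta> u a)"] that
        by (simp add: closures right_one)
      then have "inv\<^bsub>A\<^esub> (\<delta> y c) = inv\<^bsub>A\<^esub> (\<delta> u a)"
        using right_inv[OF c y] sy by simp
      then have "\<delta> u a = \<delta> y c"
        using that c y by (metis A.inv_inv right_closed)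
      then have "\<delta> (u \<otimes>\<^bsub>G\<^esub> inv\<^bsub>G\<^esub> y) a = c"
        using that c y right_mult[of y "inv\<^bsub>G\<^esub> y" c] by (simp add: right_mult right_one)
      then show ?thesis using that c y
        by (simp add: t_def matched_pair_map_def Let_def sy A.m_assoc G.m_assoc closures
            flip: c_def y_def)
    qed
    then show "\<forall>p \<in> ?S \<times> ?S. ?s (t p) = p" by auto
    show "?s ` (?S \<times> ?S) \<subseteq> ?S \<times> ?S" using matched_pair_map_closed by blast
    show "t ` (?S \<times> ?S) \<subseteq> ?S \<times> ?S"
      by (auto simp: t_def Let_def closures cc)
  qed
qed

lemma bijective_pentagon_solution_matched_pair_map:
  "X \<noteq> {} \<Longrightarrow>
   bijective_pentagon_solution (X \<times> carrier A \<times> carrier G) (matched_pair_map A G \<sigma> \<delta> X \<phi>)"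
  unfolding bijective_pentagon_solution_def pentagon_solution_def
  using matched_pair_map_closed matched_pair_map_bij matched_pair_map_pentagon A.one_closed G.one_closed
  by (auto simp del: comp_apply)

end

section \<open>The left group underlying a finite bijective solution\<close>

locale finite_pentagon =
  fixes S :: "'s set" and mul :: "'s \<Rightarrow> 's \<Rightarrow> 's" (infixl \<open>\<odot>\<close> 70) and \<theta> :: "'s \<Rightarrow> 's \<Rightarrow> 's"
  assumes finite_S: "finite S" and nonempty: "S \<noteq> {}"
    and closed: "\<lbrakk>x \<in> S; y \<in> S\<rbrakk> \<Longrightarrow> x \<odot> y \<in> S"
    and \<theta>_closed: "\<lbrakk>x \<in> S; y \<in> S\<rbrakk> \<Longrightarrow> \<theta> x y \<in> S"
    and assoc: "\<lbrakk>x \<in> S; y \<in> S; z \<in> S\<rbrakk> \<Longrightarrow> x \<odot> y \<odot> z = x \<odot> (y \<odot> z)"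
    and \<theta>_mul: "\<lbrakk>x \<in> S; y \<in> S; z \<in> S\<rbrakk> \<Longrightarrow> \<theta> x (y \<odot> z) = \<theta> x y \<odot> \<theta> (x \<odot> y) z"
    and \<theta>_\<theta>: "\<lbrakk>x \<in> S; y \<in> S; z \<in> S\<rbrakk> \<Longrightarrow> \<theta> (\<theta> x y) (\<theta> (x \<odot> y) z) = \<theta> y z"
    and pair_bij: "bij_betw (\<lambda>(x, y). (x \<odot> y, \<theta> x y)) (S \<times> S) (S \<times> S)"
begin

lemma pair_inj:
  "\<lbrakk>x \<odot> y = x' \<odot> y'; \<theta> x y = \<theta> x' y'; x \<in> S; y \<in> S; x' \<in> S; y' \<in> S\<rbrakk> \<Longrightarrow> x = x' \<and> y = y'"
  using pair_bij unfolding bij_betw_def inj_on_def by (metis (no_types, lifting) SigmaI case_prod_conv prod.inject)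

lemma pair_surj:
  assumes "u \<in> S" "v \<in> S"
  obtains x y where "x \<in> S" "y \<in> S" "x \<odot> y = u" "\<theta> x y = v"
proof -
  have "(u, v) \<in> (\<lambda>(x, y). (x \<odot> y, \<theta> x y)) ` (S \<times> S)"
    using pair_bij assms by (simp add: bij_betw_def)
  then show ?thesis using that by auto
qed

text \<open>A left ideal \<open>S w\<close> of least cardinality works: for \<open>v\<close> in it,
  \<open>S v\<close> is contained in \<open>S w\<close> and cannot be smaller.\<close>

lemma minimal_left_ideal:
  obtains L where "L \<noteq> {}" "L \<subseteq> S" "\<And>v. v \<in> L \<Longrightarrow> (\<lambda>x. x \<odot> v) ` S = L"
proof -
  let ?I = "\<lambda>v. (\<lambda>x. x \<odot> v) ` S"
  obtain w where w: "w \<in> S" and min: "\<And>v. v \<in> S \<Longrightarrow> card (?I w) \<le> card (?I v)"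
    using nonempty ex_has_least_nat[of "\<lambda>v. v \<in> S" _ "\<lambda>v. card (?I v)"] by blast
  have sub: "?I w \<subseteq> S" using w closed by auto
  have "?I v = ?I w" if v: "v \<in> ?I w" for v
  proof (rule card_subset_eq)
    show "finite (?I w)" using finite_S by simp
    obtain z where z: "z \<in> S" "v = z \<odot> w" using v by auto
    show s: "?I v \<subseteq> ?I w"
      using w z by (auto simp flip: assoc intro!: imageI closed)
    have "v \<in> S" using v sub by auto
    then show "card (?I v) = card (?I w)"
      using min s finite_S by (simp add: card_mono le_antisym)
  qed
  then show ?thesis using that[of "?I w"] nonempty sub by blast
qed

text \<open>Bijectivity of \<open>s\<close> makes every element a product in exactly \<open>card S\<close> ways, so a left
  ideal \<open>L\<close> contains no product beyond those in \<open>S \<times> L\<close>.\<close>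

lemma left_ideal_prime:
  assumes L: "L \<subseteq> S" "\<And>x v. \<lbrakk>x \<in> S; v \<in> L\<rbrakk> \<Longrightarrow> x \<odot> v \<in> L"
    and "x \<in> S" "u \<in> S" "x \<odot> u \<in> L"
  shows "u \<in> L"
proof -
  let ?f = "\<lambda>(x, y). (x \<odot> y, \<theta> x y)"
  have inj: "inj_on ?f (S \<times> S)" using pair_bij by (simp add: bij_betw_def)
  have "?f ` (S \<times> L) = L \<times> S"
  proof (rule card_subset_eq)
    show "finite (L \<times> S)" using finite_S finite_subset[OF L(1)] by auto
    show "?f ` (S \<times> L) \<subseteq> L \<times> S" using L \<theta>_closed by auto
    have "inj_on ?f (S \<times> L)" by (rule inj_on_subset[OF inj]) (use L in auto)
    then show "card (?f ` (S \<times> L)) = card (L \<times> S)"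
      by (simp add: card_image card_cartesian_product)
  qed
  moreover have "(x \<odot> u, \<theta> x u) \<in> L \<times> S" using assms \<theta>_closed by auto
  ultimately obtain x' u' where "x' \<in> S" "u' \<in> L" "x \<odot> u = x' \<odot> u'" "\<theta> x u = \<theta> x' u'"
    by (smt (verit, best) SigmaE case_prod_conv image_iff prod.inject)
  then show ?thesis using pair_inj[of x u x' u'] assms by blast
qed

text \<open>The minimal left ideal contains a right identity of all of \<open>S\<close>, so it
  equals \<open>S\<close> and each element generates \<open>S\<close>.\<close>

lemma right_mult_onto: "v \<in> S \<Longrightarrow> (\<lambda>x. x \<odot> v) ` S = S"
proof -
  obtain L where ne: "L \<noteq> {}" and sub: "L \<subseteq> S" and L: "\<And>v. v \<in> L \<Longrightarrow> (\<lambda>x. x \<odot> v) ` S = L"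
    by (rule minimal_left_ideal) blast
  have ideal: "x \<odot> v \<in> L" if "x \<in> S" "v \<in> L" for x v using L that by blast
  have finL: "finite L" using finite_S sub finite_subset by auto
  obtain v where v: "v \<in> L" using ne by auto
  \<comment> \<open>\<open>v \<odot> v\<close> generates \<open>L\<close> as well, so
    \<open>y = x \<odot> v \<odot> v\<close> with \<open>x \<odot> v\<close> in
    \<open>L\<close>.\<close>
  have "L \<subseteq> (\<lambda>x. x \<odot> v) ` L"
  proof
    fix y assume "y \<in> L"
    moreover have "v \<odot> v \<in> L" using ideal v sub by auto
    ultimately obtain x where "x \<in> S" "y = x \<odot> (v \<odot> v)" using L by blast
    then show "y \<in> (\<lambda>x. x \<odot> v) ` L"
      using v sub ideal by (auto intro!: image_eqI[of _ _ "x \<odot> v"] simp: assoc)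
  qed
  then have onto: "(\<lambda>x. x \<odot> v) ` L = L" using ideal v sub by auto
  then have inj: "inj_on (\<lambda>x. x \<odot> v) L" using finL by (simp add: eq_card_imp_inj_on)
  \<comment> \<open>Cancelling \<open>v\<close> in
    \<open>u \<odot> e \<odot> v = u \<odot> v\<close> will make \<open>e\<close> a right identity
    on \<open>L\<close>.\<close>
  obtain e where e: "e \<in> L" "e \<odot> v = v" using onto v by (metis image_iff)
  have ue: "u \<odot> e = u" if "u \<in> L" for u
    by (rule inj_onD[OF inj]) (use that e v sub ideal in \<open>auto simp: assoc subset_iff\<close>)
  \<comment> \<open>\<open>c\<close> serves every \<open>p\<close>: by \<open>\<theta>_mul\<close>,
    \<open>x \<odot> u = v\<close> gives
    \<open>\<theta> x (u \<odot> e) = \<theta> x u \<odot> c\<close>.\<close>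
  define c where "c = \<theta> v e"
  have vS: "v \<in> S" and eS: "e \<in> S" using v e sub by auto
  have cS: "c \<in> S" using vS eS by (simp add: c_def \<theta>_closed)
  have c: "p \<odot> c = p" if p: "p \<in> S" for p
  proof -
    obtain x u where xu: "x \<in> S" "u \<in> S" "x \<odot> u = v" "\<theta> x u = p"
      using pair_surj[OF vS p] .
    then have "u \<in> L" using left_ideal_prime[OF sub ideal] v by auto
    then show ?thesis using \<theta>_mul[of x u e] xu eS ue by (simp add: c_def)
  qed
  have "c \<in> L" using left_ideal_prime[OF sub ideal vS cS] c v vS by simp
  then have "L = S" using L[of c] c by auto
  then show "v' \<in> S \<Longrightarrow> (\<lambda>x. x \<odot> v') ` S = S" for v' using L by auto
qed

lemma right_cancel:
  assumes "x \<odot> z = y \<odot> z" "x \<in> S" "y \<in> S" "z \<in> S" shows "x = y"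
proof -
  have "inj_on (\<lambda>x. x \<odot> z) S"
    by (rule eq_card_imp_inj_on[OF finite_S]) (simp only: right_mult_onto[OF assms(4)])
  from inj_onD[OF this, of x y] show ?thesis using assms by blast
qed

lemma left_divisor:
  assumes "u \<in> S" "y \<in> S" obtains x where "x \<in> S" "x \<odot> y = u"
  using right_mult_onto[OF assms(2)] assms(1) by (metis image_iff)

section \<open>Idempotents and bijectivity of the maps \<open>\<theta> x\<close>\<close>

definition idem :: "'s set" where "idem = {e \<in> S. e \<odot> e = e}"

lemma idem_S: "e \<in> idem \<Longrightarrow> e \<in> S"
  by (simp add: idem_def)

text \<open>Cancel \<open>e\<close> in \<open>x \<odot> e \<odot> e = x \<odot> e\<close>.\<close>

lemma mul_idem: "\<lbrakk>x \<in> S; e \<in> idem\<rbrakk> \<Longrightarrow> x \<odot> e = x"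
  using right_cancel[of "x \<odot> e" e x] by (auto simp: idem_def assoc closed)

text \<open>Writing \<open>b = z \<odot> a\<close> gives
  \<open>b \<odot> b = z \<odot> (a \<odot> b) = z \<odot> a = b\<close>.\<close>

lemma idemI:
  assumes "a \<odot> b = a" "a \<in> S" "b \<in> S" shows "b \<in> idem"
proof -
  obtain z where "z \<in> S" "z \<odot> a = b" using left_divisor[OF assms(3) assms(2)] .
  then show ?thesis using assms assoc[of z a b] by (auto simp: idem_def)
qed

lemma left_unit_idem: "\<lbrakk>e \<odot> p = p; e \<in> S; p \<in> S\<rbrakk> \<Longrightarrow> e \<in> idem"
  using right_cancel[of "e \<odot> e" p e] by (auto simp: idem_def assoc closed)

text \<open>Since \<open>x \<odot> e = x\<close>, expanding \<open>\<theta> x (e \<odot> e)\<close>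
  by \<open>\<theta>_mul\<close> gives the same \<open>\<theta> x\<close> in both factors.\<close>

lemma \<theta>_idem:
  assumes "x \<in> S" "e \<in> idem" shows "\<theta> x e \<in> idem"
proof (rule idemI)
  have e: "e \<in> S" using assms by (simp add: idem_S)
  have "\<theta> x e \<odot> \<theta> x e = \<theta> x (e \<odot> e)"
    using \<theta>_mul[OF assms(1) e e] mul_idem[OF assms] by simp
  then show "\<theta> x e \<odot> \<theta> x e = \<theta> x e" using mul_idem[OF e assms(2)] by simp
  show "\<theta> x e \<in> S" "\<theta> x e \<in> S" using assms e \<theta>_closed by auto
qed

lemma \<theta>_idem_mul: "\<lbrakk>x \<in> S; e \<in> idem; y \<in> S\<rbrakk> \<Longrightarrow> \<theta> x (e \<odot> y) = \<theta> x e \<odot> \<theta> x y"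
  by (simp add: \<theta>_mul mul_idem idem_S)

text \<open>With \<open>u = x \<odot> y\<close>, the map \<open>\<theta> u\<close> permutes the
  idempotents. So the pairs \<open>(x, y)\<close> and \<open>(u, e)\<close> have the same image for
  some idempotent \<open>e\<close>, and \<open>y = e\<close> by \<open>pair_inj\<close>.\<close>

lemma \<theta>_idem_iff:
  assumes "x \<in> S" "y \<in> S" "\<theta> x y \<in> idem" shows "y \<in> idem"
proof -
  let ?u = "x \<odot> y"
  have u: "?u \<in> S" using assms closed by auto
  have "inj_on (\<theta> ?u) idem"
  proof (rule inj_onI)
    fix e f assume "e \<in> idem" "f \<in> idem" "\<theta> ?u e = \<theta> ?u f"
    then have "?u = ?u \<and> e = f"
      by (intro pair_inj) (use u in \<open>simp_all add: mul_idem idem_S\<close>)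
    then show "e = f" by simp
  qed
  moreover have "finite idem" using finite_S by (simp add: idem_def)
  moreover have "\<theta> ?u ` idem \<subseteq> idem" using u \<theta>_idem by auto
  ultimately have "\<theta> ?u ` idem = idem" by (simp add: endo_inj_surj)
  then obtain e where e: "e \<in> idem" "\<theta> x y = \<theta> ?u e" using assms(3) by blast
  have "?u = x \<and> e = y"
    by (rule pair_inj) (use e(1) assms(1,2) u e(2)[symmetric] in \<open>simp_all add: mul_idem idem_S\<close>)
  then show ?thesis using e(1) by simp
qed

text \<open>By \<open>pair_inj\<close> it suffices that \<open>x \<odot> y = x \<odot> y'\<close>.
  The quotient \<open>h\<close> of \<open>y'\<close> by \<open>y\<close> is shown to be idempotent,
  so multiplying by it on the right changes nothing.\<close>

lemma \<theta>_inj: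
  assumes "\<theta> x y = \<theta> x y'" "x \<in> S" "y \<in> S" "y' \<in> S" shows "y = y'"
proof -
  obtain e where e: "e \<in> S" "e \<odot> y = y" using left_divisor[OF assms(3) assms(3)] .
  \<comment> \<open>\<open>k\<close> acts as an inverse of \<open>y\<close>: both
    \<open>k \<odot> y\<close> and \<open>y \<odot> k\<close> are idempotent, and the latter is the
    left unit of \<open>y\<close>.\<close>
  obtain k where k: "k \<in> S" "k \<odot> y = e" using left_divisor[OF e(1) assms(3)] .
  have ei: "e \<in> idem" using left_unit_idem[of e y] e assms by simp
  define f where "f = y \<odot> k"
  have fy: "f \<odot> y = y" using assms k ei by (simp add: f_def assoc mul_idem)
  have f: "f \<in> idem" using left_unit_idem[OF fy] assms k by (simp add: f_def closed)
  define h where "h = k \<odot> y'"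
  have h: "h \<in> S" using k assms closed by (simp add: h_def)
  have yh: "y \<odot> h = f \<odot> y'" using k assms by (simp add: h_def f_def assoc)
  have "\<theta> x y \<odot> \<theta> (x \<odot> y) h = \<theta> x f \<odot> \<theta> x y'"
    using yh \<theta>_mul[of x y h] h assms f by (simp add: \<theta>_idem_mul)
  also have "\<dots> = \<theta> x y"
    using \<theta>_idem_mul[OF assms(2) f assms(3)] unfolding fy assms(1) by (rule sym)
  finally have "\<theta> (x \<odot> y) h \<in> idem"
    using idemI assms h by (simp add: \<theta>_closed closed)
  then have hi: "h \<in> idem" using \<theta>_idem_iff[of "x \<odot> y" h] assms h closed by blast
  have "x \<odot> y = x \<odot> (y \<odot> h)" using assms hi by (simp add: mul_idem)
  also have "\<dots> = x \<odot> y'"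
    unfolding yh using assms f by (simp add: mul_idem idem_S flip: assoc)
  finally show ?thesis using pair_inj[of x y x y'] assms by blast
qed

lemma \<theta>_onto: assumes x: "x \<in> S" shows "\<theta> x ` S = S"
proof (rule endo_inj_surj)
  show "\<theta> x ` S \<subseteq> S" using \<theta>_closed[OF x] by blast
  show "inj_on (\<theta> x) S"
  proof (rule inj_onI)
    fix y y' assume "y \<in> S" "y' \<in> S" "\<theta> x y = \<theta> x y'"
    then show "y = y'" using \<theta>_inj[of x y y'] x by simp
  qed
qed (rule finite_S)

text \<open>For any idempotent \<open>e\<close>, \<open>\<theta>_\<theta>\<close> says that
  \<open>\<theta> (\<theta> e e)\<close> fixes every value of \<open>\<theta> e\<close>, and
  \<open>\<theta> e\<close> is onto.\<close>

lemma ex_trivial_idem: "\<exists>e \<in> idem. \<forall>y \<in> S. \<theta> e y = y"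
proof -
  obtain p where p: "p \<in> S" using nonempty by auto
  obtain e where "e \<in> S" "e \<odot> p = p" using left_divisor[OF p p] .
  then have e: "e \<in> idem" using left_unit_idem[of e p] p by simp
  have "\<theta> (\<theta> e e) y = y" if y: "y \<in> S" for y
  proof -
    obtain z where "z \<in> S" "y = \<theta> e z" using \<theta>_onto[OF idem_S[OF e]] y by blast
    then show ?thesis using \<theta>_\<theta>[of e e z] mul_idem[of e e] idem_S[OF e] e by simp
  qed
  then show ?thesis using \<theta>_idem[OF idem_S[OF e] e] by blast
qed

text \<open>The left zero coordinate of \<open>p\<close> in the left group; by right cancellation
  the choice is unique.\<close>

definition lid :: "'s \<Rightarrow> 's" where "lid p = (SOME e. e \<in> S \<and> e \<odot> p = p)"

lemma lid:
  assumes "p \<in> S" shows "lid p \<in> idem" "lid p \<odot> p = p"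
proof -
  have "\<exists>e. e \<in> S \<and> e \<odot> p = p" using left_divisor[OF assms assms] by blast
  then have "lid p \<in> S \<and> lid p \<odot> p = p" unfolding lid_def by (rule someI_ex)
  then show "lid p \<in> idem" "lid p \<odot> p = p" using left_unit_idem[of "lid p" p] assms by auto
qed

lemma lid_eqI: "\<lbrakk>e \<odot> p = p; e \<in> S; p \<in> S\<rbrakk> \<Longrightarrow> lid p = e"
  using lid[of p] right_cancel[of "lid p" p e] by (auto simp: idem_S)

lemma lid_mul: "\<lbrakk>p \<in> S; q \<in> S\<rbrakk> \<Longrightarrow> lid (p \<odot> q) = lid p"
  by (rule lid_eqI) (auto simp: lid idem_S closed simp flip: assoc)

lemma lid_\<theta>: "\<lbrakk>p \<in> S; q \<in> S\<rbrakk> \<Longrightarrow> lid (\<theta> p q) = \<theta> p (lid q)"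
  by (intro lid_eqI) (simp_all add: lid idem_S \<theta>_closed flip: \<theta>_idem_mul)

end

section \<open>The group of permutations \<open>\<theta> x\<close>, with base point
  \<open>e0\<close>\<close>

locale pointed_finite_pentagon = finite_pentagon +
  fixes e0
  assumes e0_idem: "e0 \<in> idem" and \<theta>_e0: "y \<in> S \<Longrightarrow> \<theta> e0 y = y"
begin

lemma e0_S: "e0 \<in> S" using e0_idem by (rule idem_S)

lemma mul_e0_mul: "\<lbrakk>x \<in> S; y \<in> S\<rbrakk> \<Longrightarrow> x \<odot> (e0 \<odot> y) = x \<odot> y"
  by (simp add: e0_S e0_idem mul_idem flip: assoc)

text \<open>The group of all \<open>\<theta>\<^sub>x\<close> acts freely on the idempotents because
  \<open>\<theta>\<close> at \<open>\<theta>\<^sub>x(e)\<close> equals \<open>\<theta>\<^sub>e \<theta>\<^sub>x\<inverse>\<close>. It is encoded inside \<open>S\<close> as the orbit of \<open>e0\<close>.\<close>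

lemma \<theta>_\<theta>_idem: "\<lbrakk>x \<in> S; e \<in> idem; y \<in> S\<rbrakk> \<Longrightarrow> \<theta> (\<theta> x e) (\<theta> x y) = \<theta> e y"
  using \<theta>_\<theta>[of x e y] by (simp add: mul_idem idem_S)

text \<open>An idempotent whose \<open>\<theta>\<close> inverts \<open>\<theta> x\<close>.\<close>

definition \<theta>inv :: "'a \<Rightarrow> 'a" where "\<theta>inv x = \<theta> x e0"

lemma \<theta>inv_idem: "x \<in> S \<Longrightarrow> \<theta>inv x \<in> idem"
  by (simp add: \<theta>inv_def \<theta>_idem e0_idem)

lemma \<theta>inv_\<theta>: "\<lbrakk>x \<in> S; y \<in> S\<rbrakk> \<Longrightarrow> \<theta> (\<theta>inv x) (\<theta> x y) = y"
  by (simp add: \<theta>inv_def \<theta>_\<theta>_idem e0_idem \<theta>_e0)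

lemma \<theta>_\<theta>inv:
  assumes "x \<in> S" "y \<in> S" shows "\<theta> x (\<theta> (\<theta>inv x) y) = y"
proof -
  obtain z where "z \<in> S" "y = \<theta> x z" using \<theta>_onto[OF assms(1)] assms(2) by blast
  then show ?thesis using assms by (simp add: \<theta>inv_\<theta>)
qed

lemma \<theta>_of_\<theta>_idem:
  assumes "x \<in> S" "e \<in> idem" "y \<in> S"
  shows "\<theta> (\<theta> x e) y = \<theta> e (\<theta> (\<theta>inv x) y)"
  using \<theta>_\<theta>_idem[of x e "\<theta> (\<theta>inv x) y"] assms
  by (simp add: \<theta>_\<theta>inv \<theta>_closed \<theta>inv_idem idem_S)

text \<open>The condition \<open>\<theta> a a = e0\<close> selects one idempotent for each
  permutation \<open>\<theta> x\<close>, namely the preimage of \<open>e0\<close>.\<close>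

definition Acar :: "'a set" where "Acar = {a \<in> idem. \<theta> a a = e0}"

lemma Acar_idem: "a \<in> Acar \<Longrightarrow> a \<in> idem" and Acar_S: "a \<in> Acar \<Longrightarrow> a \<in> S"
  by (auto simp: Acar_def idem_S)

text \<open>Both \<open>\<theta> a a\<close> and \<open>\<theta> a b = \<theta> b b\<close> are
  \<open>e0\<close>.\<close>

lemma Acar_eqI:
  assumes "a \<in> Acar" "b \<in> Acar" "\<And>y. y \<in> S \<Longrightarrow> \<theta> a y = \<theta> b y" shows "a = b"
proof (rule \<theta>_inj)
  show "\<theta> a a = \<theta> a b" using assms Acar_S[of b] by (auto simp: Acar_def)
qed (use assms Acar_S in auto)

lemma \<theta>inv_Acar: "x \<in> S \<Longrightarrow> \<theta>inv x \<in> Acar"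
  using \<theta>inv_\<theta>[of x e0] by (simp add: Acar_def \<theta>inv_idem e0_S) (simp add: \<theta>inv_def)

text \<open>Inverting twice yields the element of \<open>Acar\<close> that has the same permutation
  as \<open>x\<close>.\<close>

definition rep :: "'a \<Rightarrow> 'a" where "rep x = \<theta>inv (\<theta>inv x)"

lemma rep_Acar: "x \<in> S \<Longrightarrow> rep x \<in> Acar"
  by (simp add: rep_def \<theta>inv_Acar Acar_S)

lemma \<theta>_rep: "\<lbrakk>x \<in> S; y \<in> S\<rbrakk> \<Longrightarrow> \<theta> (rep x) y = \<theta> x y"
  using \<theta>inv_\<theta>[of "\<theta>inv x" "\<theta> x y"] by (simp add: rep_def \<theta>inv_\<theta> \<theta>_closed \<theta>inv_Acar Acar_S)

text \<open>The product encodes composition: by \<open>\<theta>_of_\<theta>_idem\<close> its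
  \<open>\<theta>\<close> is \<open>\<theta> a\<close> after \<open>\<theta> (rep b)\<close>, which
  is \<open>\<theta> b\<close>.\<close>

definition Agrp :: "'a monoid" where
  "Agrp = \<lparr>carrier = Acar, mult = (\<lambda>a b. \<theta> (\<theta>inv b) a), one = e0\<rparr>"

lemma carrier_Agrp [simp]: "carrier Agrp = Acar" by (simp add: Agrp_def)

lemma one_Agrp [simp]: "\<one>\<^bsub>Agrp\<^esub> = e0" by (simp add: Agrp_def)

lemma \<theta>_mult_Agrp:
  assumes "a \<in> Acar" "b \<in> Acar" "y \<in> S" shows "\<theta> (a \<otimes>\<^bsub>Agrp\<^esub> b) y = \<theta> a (\<theta> b y)"
  using assms \<theta>_of_\<theta>_idem[of "\<theta>inv b" a y] \<theta>_rep[of b y]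
  by (simp add: Agrp_def rep_def Acar_S Acar_idem \<theta>inv_Acar)

lemma mult_Agrp_closed:
  assumes "a \<in> Acar" "b \<in> Acar" shows "a \<otimes>\<^bsub>Agrp\<^esub> b \<in> Acar"
proof -
  have i: "a \<otimes>\<^bsub>Agrp\<^esub> b \<in> idem"
    using assms by (simp add: Agrp_def \<theta>_idem Acar_S Acar_idem \<theta>inv_Acar)
  have "\<theta> (a \<otimes>\<^bsub>Agrp\<^esub> b) (a \<otimes>\<^bsub>Agrp\<^esub> b) = \<theta> a (\<theta> b (\<theta> (\<theta>inv b) a))"
    using assms i by (simp add: \<theta>_mult_Agrp idem_S) (simp add: Agrp_def)
  also have "\<dots> = e0" using assms by (simp add: \<theta>_\<theta>inv Acar_S) (simp add: Acar_def)
  finally show ?thesis using i by (simp add: Acar_def)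
qed

lemma e0_Acar: "e0 \<in> Acar"
  by (simp add: Acar_def e0_idem \<theta>_e0 e0_S)

text \<open>By \<open>Acar_eqI\<close> the group laws may be checked on the permutations.\<close>

lemma group_Agrp: "group Agrp"
proof (rule groupI; simp)
  show "e0 \<in> Acar" by (rule e0_Acar)
  fix a b assume a: "a \<in> Acar" and b: "b \<in> Acar"
  show "a \<otimes>\<^bsub>Agrp\<^esub> b \<in> Acar" using a b by (rule mult_Agrp_closed)
  show "e0 \<otimes>\<^bsub>Agrp\<^esub> a = a"
    by (rule Acar_eqI) (use a in \<open>auto simp: mult_Agrp_closed \<theta>_mult_Agrp e0_Acar \<theta>_e0 \<theta>_closed Acar_S\<close>)
  have "\<theta>inv a \<otimes>\<^bsub>Agrp\<^esub> a = e0"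
    by (rule Acar_eqI) (use a in \<open>auto simp: mult_Agrp_closed \<theta>_mult_Agrp e0_Acar \<theta>_e0 \<theta>inv_Acar \<theta>inv_\<theta> Acar_S\<close>)
  then show "\<exists>y\<in>Acar. y \<otimes>\<^bsub>Agrp\<^esub> a = e0" using a \<theta>inv_Acar Acar_S by blast
  fix c assume c: "c \<in> Acar"
  show "a \<otimes>\<^bsub>Agrp\<^esub> b \<otimes>\<^bsub>Agrp\<^esub> c = a \<otimes>\<^bsub>Agrp\<^esub> (b \<otimes>\<^bsub>Agrp\<^esub> c)"
    by (rule Acar_eqI) (use a b c in \<open>auto simp: mult_Agrp_closed \<theta>_mult_Agrp \<theta>_closed Acar_S\<close>)
qed

lemma \<theta>_inv_Agrp:
  assumes "a \<in> Acar" "y \<in> S" shows "\<theta> (inv\<^bsub>Agrp\<^esub> a) y = \<theta> (\<theta>inv a) y"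
proof -
  have "\<theta>inv a \<otimes>\<^bsub>Agrp\<^esub> a = e0"
    by (rule Acar_eqI)
      (use assms in \<open>auto simp: mult_Agrp_closed \<theta>_mult_Agrp e0_Acar \<theta>_e0 \<theta>inv_Acar \<theta>inv_\<theta> Acar_S\<close>)
  then have "inv\<^bsub>Agrp\<^esub> a = \<theta>inv a"
    using assms group.inv_equality[OF group_Agrp, of "\<theta>inv a" a] by (simp add: \<theta>inv_Acar Acar_S)
  then show ?thesis by simp
qed

section \<open>The maximal subgroup with unit \<open>e0\<close>\<close>

definition Gcar :: "'a set" where "Gcar = {g \<in> S. e0 \<odot> g = g}"

definition Ggrp :: "'a monoid" where
  "Ggrp = \<lparr>carrier = Gcar, mult = mul, one = e0\<rparr>"

lemma Ggrp_simps [simp]: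
  "carrier Ggrp = Gcar" "\<one>\<^bsub>Ggrp\<^esub> = e0" "x \<otimes>\<^bsub>Ggrp\<^esub> y = x \<odot> y"
  by (simp_all add: Ggrp_def)

lemma Gcar_S: "g \<in> Gcar \<Longrightarrow> g \<in> S" by (simp add: Gcar_def)

lemma e0_mul_Gcar: "p \<in> S \<Longrightarrow> e0 \<odot> p \<in> Gcar"
  by (simp add: Gcar_def closed e0_S mul_e0_mul)

lemma Gcar_closed: "\<lbrakk>x \<in> Gcar; y \<in> S\<rbrakk> \<Longrightarrow> x \<odot> y \<in> Gcar"
  by (auto simp: Gcar_def closed e0_S simp flip: assoc)

lemma e0_Gcar: "e0 \<in> Gcar" by (simp add: Gcar_def e0_S e0_idem mul_idem)

lemma group_Ggrp: "group Ggrp"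
proof (rule groupI; simp)
  show "e0 \<in> Gcar" by (rule e0_Gcar)
  fix x y assume x: "x \<in> Gcar" and y: "y \<in> Gcar"
  show "x \<odot> y \<in> Gcar" using x y by (simp add: Gcar_closed Gcar_S)
  show "e0 \<odot> x = x" using x by (simp add: Gcar_def)
  obtain z where "z \<in> S" "z \<odot> x = e0" using left_divisor[OF e0_S Gcar_S[OF x]] .
  then show "\<exists>y\<in>Gcar. y \<odot> x = e0"
    using x by (intro bexI[of _ "e0 \<odot> z"]) (auto simp: assoc e0_S Gcar_S e0_mul_Gcar e0_idem mul_idem)
  fix z assume "z \<in> Gcar"
  then show "x \<odot> y \<odot> z = x \<odot> (y \<odot> z)" using x y by (simp add: assoc Gcar_S)
qed

text \<open>The extra factor \<open>\<theta> p e0\<close> is idempotent and is absorbed by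
  \<open>e0\<close>. Hence \<open>\<theta> p\<close> induces a map on \<open>Gcar\<close>.\<close>

lemma e0_\<theta>_e0_mul: "\<lbrakk>p \<in> S; y \<in> S\<rbrakk> \<Longrightarrow> e0 \<odot> \<theta> p (e0 \<odot> y) = e0 \<odot> \<theta> p y"
  by (simp add: \<theta>_idem_mul e0_idem e0_S idem_S \<theta>_idem \<theta>_closed mul_idem flip: assoc)

text \<open>By \<open>\<theta>_\<theta>\<close> at \<open>e0\<close> the map
  \<open>\<theta> x\<close> is idempotent, and it is injective.\<close>

lemma \<theta>_Gcar:
  assumes "x \<in> Gcar" "y \<in> S" shows "\<theta> x y = y"
proof (rule \<theta>_inj)
  show "\<theta> x (\<theta> x y) = \<theta> x y"
    using \<theta>_\<theta>[of e0 x y] assms by (simp add: e0_S \<theta>_e0 Gcar_S) (simp add: Gcar_def)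
qed (use assms Gcar_S \<theta>_closed in auto)

text \<open>Solving \<open>\<theta>_\<theta>\<close> for \<open>\<theta> (p \<odot> x)\<close> shows
  that it depends on \<open>p\<close> only through \<open>\<theta> p\<close>.\<close>

lemma \<theta>_mul_left:
  assumes "p \<in> S" "x \<in> S" "y \<in> S" shows "\<theta> (p \<odot> x) y = \<theta> (\<theta>inv (\<theta> p x)) (\<theta> x y)"
  using \<theta>_\<theta>[of p x y] \<theta>inv_\<theta>[of "\<theta> p x" "\<theta> (p \<odot> x) y"] assms
  by (simp add: closed \<theta>_closed)

lemma \<theta>_mul_cong:
  assumes "p \<in> S" "q \<in> S" "x \<in> S" "y \<in> S" "\<And>z. z \<in> S \<Longrightarrow> \<theta> p z = \<theta> q z"
  shows "\<theta> (p \<odot> x) y = \<theta> (q \<odot> x) y"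
  using assms by (simp add: \<theta>_mul_left)

section \<open>The two actions and the matched pair\<close>

definition sig :: "'a \<Rightarrow> 'a \<Rightarrow> 'a" where
  "sig a = restrict (\<lambda>x. e0 \<odot> \<theta> a x) Gcar"

definition del :: "'a \<Rightarrow> 'a \<Rightarrow> 'a" where
  "del x = restrict (\<lambda>a. rep (a \<odot> x)) Acar"

lemma sig_closed: "\<lbrakk>a \<in> Acar; x \<in> Gcar\<rbrakk> \<Longrightarrow> sig a x \<in> Gcar"
  by (simp add: sig_def e0_mul_Gcar \<theta>_closed Acar_S Gcar_S)

lemma sig_mult:
  "\<lbrakk>a \<in> Acar; b \<in> Acar; x \<in> Gcar\<rbrakk> \<Longrightarrow> sig (a \<otimes>\<^bsub>Agrp\<^esub> b) x = sig a (sig b x)"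
  by (simp add: sig_def e0_mul_Gcar e0_\<theta>_e0_mul \<theta>_closed Acar_S Gcar_S \<theta>_mult_Agrp)

lemma sig_one: "x \<in> Gcar \<Longrightarrow> sig e0 x = x"
  by (simp add: sig_def \<theta>_e0 Gcar_S) (simp add: Gcar_def)

lemma sig_Bij:
  assumes a: "a \<in> Acar" shows "sig a \<in> Bij Gcar"
proof -
  interpret A: group Agrp by (rule group_Agrp)
  have i: "inv\<^bsub>Agrp\<^esub> a \<in> Acar" using A.inv_closed a by simp
  have "bij_betw (sig a) Gcar Gcar"
  proof (rule bij_betw_byWitness[where f' = "sig (inv\<^bsub>Agrp\<^esub> a)"])
    show "\<forall>x\<in>Gcar. sig (inv\<^bsub>Agrp\<^esub> a) (sig a x) = x"
      using a i A.l_inv[of a] by (auto simp: sig_one simp flip: sig_mult)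
    show "\<forall>x\<in>Gcar. sig a (sig (inv\<^bsub>Agrp\<^esub> a) x) = x"
      using a i A.r_inv[of a] by (auto simp: sig_one simp flip: sig_mult)
  qed (use a i sig_closed in auto)
  then show ?thesis by (simp add: Bij_def sig_def)
qed

lemma del_closed: "\<lbrakk>x \<in> Gcar; a \<in> Acar\<rbrakk> \<Longrightarrow> del x a \<in> Acar"
  by (simp add: del_def rep_Acar closed Acar_S Gcar_S)

lemma \<theta>_del: "\<lbrakk>x \<in> Gcar; a \<in> Acar; y \<in> S\<rbrakk> \<Longrightarrow> \<theta> (del x a) y = \<theta> (a \<odot> x) y"
  by (simp add: del_def \<theta>_rep closed Acar_S Gcar_S)

lemma del_mult:
  assumes "x \<in> Gcar" "y \<in> Gcar" "a \<in> Acar" shows "del (x \<odot> y) a = del y (del x a)"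
proof (rule Acar_eqI)
  fix z assume z: "z \<in> S"
  have "\<theta> (del y (del x a)) z = \<theta> (a \<odot> x \<odot> y) z"
    using assms z by (simp add: \<theta>_del del_closed)
      (intro \<theta>_mul_cong, auto simp: \<theta>_del del_closed Acar_S Gcar_S closed)
  then show "\<theta> (del (x \<odot> y) a) z = \<theta> (del y (del x a)) z"
    using assms z by (simp add: \<theta>_del Gcar_closed Gcar_S Acar_S assoc)
qed (use assms in \<open>auto simp: del_closed Gcar_closed Gcar_S\<close>)

lemma del_one: "a \<in> Acar \<Longrightarrow> del e0 a = a"
  by (rule Acar_eqI) (auto simp: del_closed \<theta>_del e0_Gcar mul_idem e0_idem Acar_S)

lemma del_Bij:
  assumes x: "x \<in> Gcar" shows "del x \<in> Bij Acar"
proof -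
  interpret G: group Ggrp by (rule group_Ggrp)
  have i: "inv\<^bsub>Ggrp\<^esub> x \<in> Gcar" using G.inv_closed x by simp
  have "bij_betw (del x) Acar Acar"
  proof (rule bij_betw_byWitness[where f' = "del (inv\<^bsub>Ggrp\<^esub> x)"])
    show "\<forall>a\<in>Acar. del (inv\<^bsub>Ggrp\<^esub> x) (del x a) = a"
      using x i G.r_inv[of x] by (auto simp: del_one simp flip: del_mult)
    show "\<forall>a\<in>Acar. del x (del (inv\<^bsub>Ggrp\<^esub> x) a) = a"
      using x i G.l_inv[of x] by (auto simp: del_one simp flip: del_mult)
  qed (use x i del_closed in auto)
  then show ?thesis by (simp add: Bij_def del_def)
qed

text \<open>This is \<open>\<theta>_mul\<close> multiplied by \<open>e0\<close> on the left, with
  \<open>\<theta> (a \<odot> x)\<close> replaced by \<open>\<theta> (del x a)\<close>.\<close>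

lemma sig_compat:
  assumes "a \<in> Acar" "x \<in> Gcar" "y \<in> Gcar"
  shows "sig a (x \<odot> y) = sig a x \<odot> sig (del x a) y"
  using assms
  by (simp add: sig_def Gcar_closed Gcar_S Acar_S \<theta>_mul \<theta>_del assoc e0_S closed \<theta>_closed
      mul_e0_mul)

text \<open>With \<open>y = \<theta> b x\<close>, both sides induce the inverse of
  \<open>\<theta> (\<theta> a y)\<close>: expand by \<open>\<theta>_mul_left\<close>, use that
  \<open>\<theta> x\<close> is trivial, and cancel \<open>\<theta> y\<close> against its
  inverse.\<close>

lemma del_compat:
  assumes "x \<in> Gcar" "a \<in> Acar" "b \<in> Acar"
  shows "del x (a \<otimes>\<^bsub>Agrp\<^esub> b) = del (sig b x) a \<otimes>\<^bsub>Agrp\<^esub> del x b"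
proof (rule Acar_eqI)
  fix z assume z: "z \<in> S"
  let ?y = "\<theta> b x"
  have S: "x \<in> S" "a \<in> S" "b \<in> S" "?y \<in> S" using assms by (auto simp: Acar_S Gcar_S \<theta>_closed)
  have ab: "a \<otimes>\<^bsub>Agrp\<^esub> b \<in> S" using assms mult_Agrp_closed Acar_S by blast
  have "a \<odot> sig b x = a \<odot> ?y"
    using assms S by (simp add: sig_def mul_e0_mul)
  then have "\<theta> (del (sig b x) a \<otimes>\<^bsub>Agrp\<^esub> del x b) z = \<theta> (a \<odot> ?y) (\<theta> (b \<odot> x) z)"
    using assms z S by (simp add: \<theta>_mult_Agrp del_closed sig_closed \<theta>_del closed \<theta>_closed)
  also have "\<dots> = \<theta> (\<theta>inv (\<theta> a ?y)) z"
    using assms z S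
    by (simp add: \<theta>_mul_left \<theta>_Gcar \<theta>_closed \<theta>_\<theta>inv \<theta>inv_Acar Acar_S)
  also have "\<dots> = \<theta> (del x (a \<otimes>\<^bsub>Agrp\<^esub> b)) z"
    using assms z S ab
    by (simp add: \<theta>_del mult_Agrp_closed \<theta>_mul_left \<theta>_Gcar \<theta>_mult_Agrp)
  finally show "\<theta> (del x (a \<otimes>\<^bsub>Agrp\<^esub> b)) z = \<theta> (del (sig b x) a \<otimes>\<^bsub>Agrp\<^esub> del x b) z" by simp
qed (use assms in \<open>auto simp: del_closed sig_closed mult_Agrp_closed\<close>)

lemma matched_pair_Agrp_Ggrp: "matched_pair Agrp Ggrp sig del"
proof -
  interpret A: group Agrp by (rule group_Agrp)
  interpret G: group Ggrp by (rule group_Ggrp)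
  have "sig \<in> hom Agrp (BijGroup Gcar)"
  proof (rule homI; simp add: BijGroup_def sig_Bij)
    fix a b assume ab: "a \<in> Acar" "b \<in> Acar"
    show "sig (a \<otimes>\<^bsub>Agrp\<^esub> b) = compose Gcar (sig a) (sig b)"
    proof (rule extensionalityI[of _ Gcar])
      show "sig (a \<otimes>\<^bsub>Agrp\<^esub> b) \<in> extensional Gcar" by (simp add: sig_def)
    qed (use ab in \<open>simp_all add: sig_mult compose_eq\<close>)
  qed
  then have "group_action Agrp (carrier Ggrp) sig"
    by (simp add: group_action_def group_hom_def group_hom_axioms_def group_Agrp group_BijGroup)
  then show ?thesis
    unfolding matched_pair_def matched_pair_axioms_def
    by (auto simp: group_Agrp group_Ggrp del_Bij del_mult sig_compat del_compat)
qed

section \<open>Coordinates on the solution\<close>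

definition Xcar :: "'a set" where "Xcar = {e \<in> idem. \<forall>y \<in> S. \<theta> e y = y}"

text \<open>With \<open>e = lid p\<close>, the first entry is the only point with trivial
  \<open>\<theta>\<close> in the orbit of \<open>e\<close>, and the second encodes the permutation
  \<open>\<theta> e\<close>.\<close>

definition coord :: "'a \<Rightarrow> 'a \<times> 'a \<times> 'a" where
  "coord p = (\<theta> (lid p) (lid p), rep (lid p), e0 \<odot> p)"

lemma coord_bij: "bij_betw coord S (Xcar \<times> Acar \<times> Gcar)"
\<comment> \<open>Since \<open>\<alpha> = \<theta> e e\<close> and
  \<open>\<theta> a = \<theta> e\<close>, the idempotent \<open>e\<close> is the preimage of
  \<open>\<alpha>\<close> under \<open>\<theta> a\<close>.\<close>
proof (rule bij_betw_byWitness[where f' = "\<lambda>(\<alpha>, a, x). \<theta> (\<theta>inv a) \<alpha> \<odot> x"])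
  show "\<forall>p\<in>S. (\<lambda>(\<alpha>, a, x). \<theta> (\<theta>inv a) \<alpha> \<odot> x) (coord p) = p"
  proof
    fix p assume p: "p \<in> S"
    let ?e = "lid p"
    have e: "?e \<in> idem" "?e \<in> S" "?e \<odot> p = p" using lid p idem_S by auto
    have "\<theta> (\<theta>inv (rep ?e)) (\<theta> ?e ?e) = ?e"
      using \<theta>inv_\<theta>[of "rep ?e" ?e] e by (simp add: \<theta>_rep rep_Acar Acar_S)
    then show "(\<lambda>(\<alpha>, a, x). \<theta> (\<theta>inv a) \<alpha> \<odot> x) (coord p) = p"
      using e p by (simp add: coord_def mul_e0_mul)
  qed
  have "coord (\<theta> (\<theta>inv a) \<alpha> \<odot> x) = (\<alpha>, a, x)"
    if "\<alpha> \<in> Xcar" "a \<in> Acar" "x \<in> Gcar" for \<alpha> a x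
  proof -
    let ?e = "\<theta> (\<theta>inv a) \<alpha>"
    have S: "\<alpha> \<in> idem" "\<alpha> \<in> S" "a \<in> S" "x \<in> S" "\<theta>inv a \<in> S" "\<theta>inv a \<in> idem"
      using that by (auto simp: Xcar_def Acar_S Gcar_S idem_S \<theta>inv_idem)
    have e: "?e \<in> idem" "?e \<in> S" using S by (auto simp: \<theta>_idem idem_S)
    have l: "lid (?e \<odot> x) = ?e"
      using lid_mul[of ?e x] lid_eqI[of ?e ?e] e S by (simp add: mul_idem)
    have te: "\<theta> ?e y = \<theta> a y" if y: "y \<in> S" for y
      using \<theta>_of_\<theta>_idem[of "\<theta>inv a" \<alpha> y] S y \<open>\<alpha> \<in> Xcar\<close>
      by (simp add: \<theta>_closed Xcar_def \<theta>inv_Acar Acar_S \<theta>_rep flip: rep_def)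
    have "rep ?e = a"
      by (rule Acar_eqI) (use that e te in \<open>auto simp: rep_Acar \<theta>_rep\<close>)
    moreover have "e0 \<odot> (?e \<odot> x) = x"
      using that e S by (simp add: e0_S mul_idem flip: assoc) (simp add: Gcar_def)
    moreover have "\<theta> ?e ?e = \<alpha>" using te e S by (simp add: \<theta>_\<theta>inv)
    ultimately show ?thesis by (simp add: coord_def l)
  qed
  then show "\<forall>q \<in> Xcar \<times> Acar \<times> Gcar. coord ((\<lambda>(\<alpha>, a, x). \<theta> (\<theta>inv a) \<alpha> \<odot> x) q) = q"
    by auto
  show "coord ` S \<subseteq> Xcar \<times> Acar \<times> Gcar"
  proof (clarsimp simp: coord_def rep_Acar lid idem_S e0_mul_Gcar)
    fix p assume p: "p \<in> S"
    have e: "lid p \<in> idem" "lid p \<in> S" using lid p idem_S by auto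
    then show "\<theta> (lid p) (lid p) \<in> Xcar"
      by (auto simp: Xcar_def \<theta>_idem \<theta>_of_\<theta>_idem \<theta>_\<theta>inv)
  qed
  show "(\<lambda>(\<alpha>, a, x). \<theta> (\<theta>inv a) \<alpha> \<odot> x) ` (Xcar \<times> Acar \<times> Gcar) \<subseteq> S"
    by (auto simp: Xcar_def Acar_S Gcar_S idem_S \<theta>inv_idem closed \<theta>_closed)
qed

text \<open>The coordinate \<open>\<theta>\<^sub>e(e)\<close> is constant on the orbits of idempotents, which is why the
  maps \<open>\<phi>\<close> may be taken to be identities.\<close>

lemma coord_map:
  assumes p: "p \<in> S" and q: "q \<in> S"
  shows "(coord (p \<odot> q), coord (\<theta> p q)) =
    matched_pair_map Agrp Ggrp sig del Xcar (\<lambda>_. \<lambda>x\<in>Xcar. x) (coord p, coord q)"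
proof -
  interpret A: group Agrp by (rule group_Agrp)
  let ?e = "lid p" and ?f = "lid q"
  have e: "?e \<in> idem" "?e \<in> S" "?e \<odot> p = p" using lid p idem_S by auto
  have f: "?f \<in> idem" "?f \<in> S" "?f \<odot> q = q" using lid q idem_S by auto
  have ra: "rep ?e \<in> Acar" "rep ?e \<in> S" and rb: "rep ?f \<in> Acar" "rep ?f \<in> S"
    using e f rep_Acar Acar_S by auto
  let ?c = "del (e0 \<odot> p) (rep ?e)"
  have c: "?c \<in> Acar" "?c \<in> S" using p ra by (auto simp: del_closed e0_mul_Gcar Acar_S)
  have ic: "inv\<^bsub>Agrp\<^esub> ?c \<in> Acar" using A.inv_closed c by simp
  \<comment> \<open>As \<open>p = ?e \<odot> p\<close>, the element \<open>?c\<close> of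
    \<open>Acar\<close> encodes exactly \<open>\<theta> p\<close>.\<close>
  have tc: "\<theta> ?c y = \<theta> p y" if y: "y \<in> S" for y
  proof -
    have "\<theta> ?c y = \<theta> (rep ?e \<odot> p) y"
      using y ra p by (simp add: \<theta>_del e0_mul_Gcar mul_e0_mul)
    also have "\<dots> = \<theta> (?e \<odot> p) y"
      by (rule \<theta>_mul_cong) (use y ra e p in \<open>auto simp: \<theta>_rep\<close>)
    finally show ?thesis using e by simp
  qed
  have tic: "\<theta> (\<theta>inv ?c) y = \<theta> (\<theta>inv p) y" if "y \<in> S" for y
    using tc[OF e0_S] by (simp add: \<theta>inv_def)
  have pf: "\<theta> p ?f \<in> idem" "\<theta> p ?f \<in> S" using f p \<theta>_idem idem_S by auto
  \<comment> \<open>\<open>\<theta>\<close> at \<open>\<theta> p ?f\<close> is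
    \<open>\<theta> ?f\<close> after the inverse of \<open>\<theta> p\<close>.\<close>
  have "rep (\<theta> p ?f) = rep ?f \<otimes>\<^bsub>Agrp\<^esub> inv\<^bsub>Agrp\<^esub> ?c"
    by (rule Acar_eqI)
      (use p f pf rb c ic in \<open>auto simp: rep_Acar mult_Agrp_closed \<theta>_rep \<theta>_mult_Agrp
        \<theta>_of_\<theta>_idem \<theta>_inv_Agrp tic \<theta>_closed \<theta>inv_Acar Acar_S\<close>)
  moreover have "\<theta> (\<theta> p ?f) (\<theta> p ?f) = \<theta> ?f ?f" using p f by (simp add: \<theta>_\<theta>_idem)
  moreover have "\<theta> ?f ?f \<in> Xcar"
    using f by (auto simp: Xcar_def \<theta>_idem \<theta>_of_\<theta>_idem \<theta>_\<theta>inv)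
  moreover have "inv_into Xcar (\<lambda>x\<in>Xcar. x) \<alpha> = \<alpha>" if "\<alpha> \<in> Xcar" for \<alpha>
    using that inv_into_f_f[of "\<lambda>x\<in>Xcar. x" Xcar \<alpha>] by (simp add: inj_on_def)
  moreover have "sig ?c (e0 \<odot> q) = e0 \<odot> \<theta> p q"
    using p q c by (simp add: sig_def e0_mul_Gcar e0_\<theta>_e0_mul tc)
  moreover have "e0 \<odot> (p \<odot> q) = (e0 \<odot> p) \<odot> (e0 \<odot> q)"
    using p q by (simp add: mul_e0_mul assoc closed e0_S)
  ultimately show ?thesis
    using p q by (simp add: coord_def lid_mul lid_\<theta> matched_pair_map_def)
qed

end

section \<open>Passage from solutions to semigroups, and the theorem\<close>

lemma finite_pentagon_of_solution:
  assumes "finite S" "bijective_pentagon_solution S s"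
  shows "finite_pentagon S (\<lambda>x y. fst (s (x, y))) (\<lambda>x y. snd (s (x, y)))"
proof -
  have ne: "S \<noteq> {}" and cl: "\<And>x y. \<lbrakk>x \<in> S; y \<in> S\<rbrakk> \<Longrightarrow> s (x, y) \<in> S \<times> S"
    and bij: "bij_betw s (S \<times> S) (S \<times> S)"
    and pent: "\<And>x y z. \<lbrakk>x \<in> S; y \<in> S; z \<in> S\<rbrakk> \<Longrightarrow>
      (on23 s \<circ> on13 s \<circ> on12 s) (x, y, z) = (on12 s \<circ> on23 s) (x, y, z)"
    using assms by (auto simp: bijective_pentagon_solution_def pentagon_solution_def simp del: comp_apply)
  \<comment> \<open>The three coordinates of the equation become \<open>assoc\<close>,
    \<open>\<theta>_mul\<close> and \<open>\<theta>_\<theta>\<close>.\<close>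
  have pent': "fst (s (fst (s (x, y)), z)) = fst (s (x, fst (s (y, z))))
      \<and> snd (s (x, fst (s (y, z)))) = fst (s (snd (s (x, y)), snd (s (fst (s (x, y)), z))))
      \<and> snd (s (snd (s (x, y)), snd (s (fst (s (x, y)), z)))) = snd (s (y, z))"
    if "x \<in> S" "y \<in> S" "z \<in> S" for x y z
    using pent[OF that] by (auto simp: on12_def on13_def on23_def split: prod.splits)
  show ?thesis
  proof
    show "bij_betw (\<lambda>(x, y). (fst (s (x, y)), snd (s (x, y)))) (S \<times> S) (S \<times> S)"
      using bij by (simp add: case_prod_unfold)
  qed (use assms ne cl pent' in \<open>auto simp: mem_Times_iff\<close>)
qed

theorem theorem1p1:
  shows "(\<forall>(S :: 's set) (s :: 's \<times> 's \<Rightarrow> 's \<times> 's).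
            finite S \<and> bijective_pentagon_solution S s \<longrightarrow>
            (\<exists>(A :: 's monoid) (G :: 's monoid) \<sigma> \<delta> (X :: 's set) \<phi> (\<iota> :: 's \<Rightarrow> 's \<times> 's \<times> 's).
               matched_pair A G \<sigma> \<delta> \<and>
               \<phi> \<in> carrier A \<rightarrow> Bij X \<and>
               bij_betw \<iota> S (X \<times> carrier A \<times> carrier G) \<and>
               (\<forall>p \<in> S. \<forall>q \<in> S.
                  map_prod \<iota> \<iota> (s (p, q)) = matched_pair_map A G \<sigma> \<delta> X \<phi> (\<iota> p, \<iota> q))))
       \<and>
         (\<forall>(A :: 'a monoid) (G :: 'g monoid) \<sigma> \<delta> (X :: 'x set) \<phi>.
            matched_pair A G \<sigma> \<delta> \<and> X \<noteq> {} \<and> \<phi> \<in> carrier A \<rightarrow> Bij X \<longrightarrow>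
            bijective_pentagon_solution (X \<times> carrier A \<times> carrier G)
              (matched_pair_map A G \<sigma> \<delta> X \<phi>))"
proof (intro conjI allI impI)
  fix S :: "'s set" and s :: "'s \<times> 's \<Rightarrow> 's \<times> 's"
  assume "finite S \<and> bijective_pentagon_solution S s"
  then interpret finite_pentagon S "\<lambda>x y. fst (s (x, y))" "\<lambda>x y. snd (s (x, y))"
    using finite_pentagon_of_solution by blast
  obtain e0 where "e0 \<in> idem" "\<forall>y \<in> S. snd (s (e0, y)) = y" using ex_trivial_idem by auto
  then interpret P: pointed_finite_pentagon S "\<lambda>x y. fst (s (x, y))" "\<lambda>x y. snd (s (x, y))" e0
    by unfold_locales auto
  have id: "(\<lambda>_. \<lambda>x\<in>P.Xcar. x) \<in> carrier P.Agrp \<rightarrow> Bij P.Xcar"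
    by (auto simp: id_Bij)
  have "\<forall>p\<in>S. \<forall>q\<in>S. map_prod P.coord P.coord (s (p, q)) =
    matched_pair_map P.Agrp P.Ggrp P.sig P.del P.Xcar (\<lambda>_. \<lambda>x\<in>P.Xcar. x) (P.coord p, P.coord q)"
  proof (intro ballI)
    fix p q assume "p \<in> S" "q \<in> S"
    from P.coord_map[OF this] show "map_prod P.coord P.coord (s (p, q)) =
      matched_pair_map P.Agrp P.Ggrp P.sig P.del P.Xcar (\<lambda>_. \<lambda>x\<in>P.Xcar. x) (P.coord p, P.coord q)"
      by (simp add: map_prod_def case_prod_unfold)
  qed
  then show "\<exists>(A :: 's monoid) (G :: 's monoid) \<sigma> \<delta> (X :: 's set) \<phi> (\<iota> :: 's \<Rightarrow> 's \<times> 's \<times> 's).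
               matched_pair A G \<sigma> \<delta> \<and>
               \<phi> \<in> carrier A \<rightarrow> Bij X \<and>
               bij_betw \<iota> S (X \<times> carrier A \<times> carrier G) \<and>
               (\<forall>p \<in> S. \<forall>q \<in> S.
                  map_prod \<iota> \<iota> (s (p, q)) = matched_pair_map A G \<sigma> \<delta> X \<phi> (\<iota> p, \<iota> q))"
    using P.matched_pair_Agrp_Ggrp id P.coord_bij[folded P.carrier_Agrp P.Ggrp_simps(1)] by blast
next
  fix A :: "'a monoid" and G :: "'g monoid" and \<sigma> \<delta> and X :: "'x set" and \<phi>
  assume H: "matched_pair A G \<sigma> \<delta> \<and> X \<noteq> {} \<and> \<phi> \<in> carrier A \<rightarrow> Bij X"
  then interpret matched_pair_maps A G \<sigma> \<delta> X \<phi>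
    by (simp add: matched_pair_maps_def matched_pair_maps_axioms_def)
  show "bijective_pentagon_solution (X \<times> carrier A \<times> carrier G) (matched_pair_map A G \<sigma> \<delta> X \<phi>)"
    using H bijective_pentagon_solution_matched_pair_map by blast
qed

end
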